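(* Let $\mathbf{H}$ be one of $\mathbf{Z}$, $\mathbf{N}$, $\mathbf{N}^+$, and let $\mu$ be the quasi-density induced by an upper quasi-density $\mu^\star$ on $\mathbf{H}$. Then the range of $\mu$ is $[0,1]$, i.e. $\{\mu(X): X\in\mathrm{dom}(\mu)\}=[0,1]$. In particular, $\mathrm{Im}(\mu^\star)=\mathrm{Im}(\mu_\star)=[0,1]$, where $\mu_\star$ is the lower dual of $\mu^\star$.
   Context: $\mathbf{N}$ is the set of non-negative integers, $\mathbf{N}^+$ the set of positive integers, $\mathcal{P}(\mathbf{H})$ the power set of $\mathbf{H}$. For $X\subseteq \mathbf{H}$, $X^c:=\mathbf{H}\setminus X$, $k\cdot X:=\{kx:x\in X\}$, $X+h:=\{x+h:x\in X\}$. An upper quasi-density on $\mathbf{H}$ is a function $\mu^\star:\mathcal{P}(\mathbf{H})\to\mathbf{R}$ such that $\mu^\star(X)\le1$ for every $X\subseteq\mathbf{H}$ and: (F1) $\mu^\star(\mathbf{H})=1$; (F3) $\mu^\star(X\cup Y)\le\mu^\star(X)+\mu^\star(Y)$ for all $X,Y\subseteq\mathbf{H}$; (F4) $\mu^\star(k\cdot X)=\frac1k\mu^\star(X)$ for all $X\subseteq\mathbf{H}$, $k\in\mathbf{N}^+$; (F5) $\mu^\star(X+h)=\mu^\star(X)$ for all $X\subseteq\mathbf{H}$, $h\in\mathbf{N}$. The (lower) dual, or conjugate, of $\mu^\star$ is $\mu_\star:\mathcal{P}(\mathbf{H})\to\mathbf{R}$, $X\mapsto 1-\mu^\star(X^c)$.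 The quasi-density induced by $\mu^\star$ is the partial function $\mu$ on $\mathcal{P}(\mathbf{H})$ with domain $\mathrm{dom}(\mu)=\{X\subseteq\mathbf{H}:\mu_\star(X)=\mu^\star(X)\}$ and $\mu(X):=\mu^\star(X)$ there. *)

theory Defs
  imports Complex_Main
begin

text \<open>
  The ambient set \<open>H\<close> is a set of integers: \<open>UNIV\<close>, \<open>{0..}\<close> and \<open>{1..}\<close> stand for the
  integers, the non-negative integers and the positive integers. A set function on the power set
  of \<open>H\<close> is a total function on \<open>int set\<close>, of which only the values at subsets of \<open>H\<close> are
  constrained or used.
\<close>

definition upper_quasi_density :: "int set \<Rightarrow> (int set \<Rightarrow> real) \<Rightarrow> bool" where
  "upper_quasi_density H m \<longleftrightarrow>
     (\<forall>X\<subseteq>H. m X \<le> 1) \<and>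
     m H = 1 \<and>
     (\<forall>X\<subseteq>H. \<forall>Y\<subseteq>H. m (X \<union> Y) \<le> m X + m Y) \<and>
     (\<forall>X\<subseteq>H. \<forall>k::nat. k \<ge> 1 \<longrightarrow> m ((\<lambda>x. int k * x) ` X) = 1 / real k * m X) \<and>
     (\<forall>X\<subseteq>H. \<forall>h::nat. m ((\<lambda>x. x + int h) ` X) = m X)"

definition lower_dual :: "int set \<Rightarrow> (int set \<Rightarrow> real) \<Rightarrow> int set \<Rightarrow> real" where
  "lower_dual H m X = 1 - m (H - X)"

definition induced_quasi_density :: "int set \<Rightarrow> (int set \<Rightarrow> real) \<Rightarrow> int set \<rightharpoonup> real" where
  "induced_quasi_density H m X =
     (if X \<subseteq> H \<and> lower_dual H m X = m X then Some (m X) else None)"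

end

theory Submission
  imports Defs
begin

text \<open>
  Subadditivity and \<open>m H = 1\<close> give \<open>1 \<le> m X + m (H - X)\<close>. Since \<open>m \<le> 1\<close>, it follows that
  all values lie in \<open>{0..1}\<close>. It also follows that a set \<open>X\<close> with \<open>m X \<le> a\<close> and
  \<open>m (H - X) \<le> 1 - a\<close> satisfies both with equality, so that \<open>X\<close> is in the domain of the induced
  quasi-density, with value \<open>a\<close>. It remains to find such a set for each \<open>a\<close> in \<open>{0..1}\<close>, and only
  upper bounds have to be proved for it.

  As \<open>m\<close> need not be monotone, a set cannot be estimated by sandwiching it between finite unions of
  residue classes. Instead the set is built to be self-similar. Let \<open>O\<close> be the set of odd elements
  of \<open>H\<close>, which has \<open>m O = 1 / 2\<close> because a translation moves it onto a translate of \<open>2 \<cdot> H\<close>.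
  Following the binary digits of \<open>a\<close>, put
  \<open>X\<^sub>a = O \<union> 2 \<cdot> X\<^bsub>2 a - 1\<^esub>\<close> if the first digit is one and \<open>X\<^sub>a = 2 \<cdot> X\<^bsub>2 a\<^esub>\<close> if it is zero; so
  membership of \<open>x\<close> depends on the digit indexed by the exponent of 2 in \<open>x\<close>. The complement of
  \<open>X\<^sub>a\<close> satisfies the same kind of recursion with the two digits exchanged. By subadditivity and the scaling law, each
  unfolding halves the error of an upper bound for the next set in the recursion. Starting from the
  trivial bound 1, the errors tend to zero (\<open>dyadic_set_approx\<close>).
\<close>

section \<open>Sets prescribed by binary digits\<close>

text \<open>
  The digits are read off a number rather than summed to it: the first one is 1 if and only if
  \<open>1 / 2 \<le> a\<close>. A dyadic rational below 1 gets its finite expansion, and 1, a fixed point, gets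
  \<open>0.111\<dots>\<close>.
\<close>

definition drop_digit :: "real \<Rightarrow> real" where
  "drop_digit a = (if 1 / 2 \<le> a then 2 * a - 1 else 2 * a)"

text \<open>
  The digit that decides on a nonzero \<open>x\<close> is the one indexed by the exponent of 2 in \<open>x\<close>. The
  inductive definition makes the self-similarity immediate and leaves out 0, for which no digit
  would decide.
\<close>

inductive dyadic :: "real \<Rightarrow> int \<Rightarrow> bool" where
  odd: "1 / 2 \<le> a \<Longrightarrow> odd x \<Longrightarrow> dyadic a x"
| double: "dyadic (drop_digit a) x \<Longrightarrow> dyadic a (2 * x)"

lemma dyadic_odd_iff: "odd x \<Longrightarrow> dyadic a x \<longleftrightarrow> 1 / 2 \<le> a"
  by (auto elim: dyadic.cases intro: dyadic.odd)

lemma dyadic_double_iff: "dyadic a (2 * x) \<longleftrightarrow> dyadic (drop_digit a) x"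
  by (auto elim: dyadic.cases intro: dyadic.double)

lemma drop_digit_in_unit: "a \<in> {0..1} \<Longrightarrow> drop_digit a \<in> {0..1}"
  by (auto simp: drop_digit_def)

lemma le_if_le_add_half_powers:
  fixes x y :: real
  assumes "\<And>n. x \<le> y + (1 / 2) ^ n"
  shows "x \<le> y"
proof (rule field_le_epsilon)
  fix e :: real
  assume "0 < e"
  then obtain n where "(1 / 2) ^ n < e"
    using real_arch_pow_inv[of e "1 / 2"] by auto
  then show "x \<le> y + e"
    using assms[of n] by simp
qed

section \<open>Upper quasi-densities\<close>

locale upper_quasi_density_on =
  fixes H :: "int set" and m :: "int set \<Rightarrow> real"
  assumes ambient: "H = UNIV \<or> H = {0..} \<or> H = {1..}"
    and upper_quasi_density: "upper_quasi_density H m"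
begin

lemma le_one: "X \<subseteq> H \<Longrightarrow> m X \<le> 1"
  and ambient_one: "m H = 1"
  and subadditive: "X \<subseteq> H \<Longrightarrow> Y \<subseteq> H \<Longrightarrow> m (X \<union> Y) \<le> m X + m Y"
  and scale: "X \<subseteq> H \<Longrightarrow> k \<ge> 1 \<Longrightarrow> m ((\<lambda>x. int k * x) ` X) = 1 / real k * m X"
  and translate: "X \<subseteq> H \<Longrightarrow> m ((\<lambda>x. x + int h) ` X) = m X"
  using upper_quasi_density by (auto simp: upper_quasi_density_def)

lemma double_half: "X \<subseteq> H \<Longrightarrow> m ((*) 2 ` X) = m X / 2"
  using scale[of X 2] by simp

lemma one_le_add_complement: "X \<subseteq> H \<Longrightarrow> 1 \<le> m X + m (H - X)"
  using subadditive[of X "H - X"] ambient_one by (simp add: Un_absorb1)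

lemma nonneg: "X \<subseteq> H \<Longrightarrow> 0 \<le> m X"
  using one_le_add_complement[of X] le_one[of "H - X"] by auto

lemma double_mem_iff: "2 * x \<in> H \<longleftrightarrow> x \<in> H"
  using ambient by auto

lemma double_ambient_subset: "(*) 2 ` H \<subseteq> H"
  by (auto simp: double_mem_iff)

text \<open>
  In \<open>UNIV\<close> and \<open>{1..}\<close> the successors of the odd elements are exactly the elements of
  \<open>2 \<cdot> H\<close>. In \<open>{0..}\<close> the successor 0 is missing, and one more translation by 2 repairs this.
\<close>

lemma density_odds: "m {x \<in> H. odd x} = 1 / 2"
proof -
  let ?odds = "{x \<in> H. odd x}"
  have "m ?odds = m ((\<lambda>x. x + int 1) ` ?odds)"
    using translate[of ?odds 1] by auto
  also have "\<dots> = m ((*) 2 ` H)"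
  proof (cases "H = {0..}")
    case True
    have "(\<lambda>x. x + int 1) ` ?odds = (\<lambda>x. x + int 2) ` ((*) 2 ` H)"
    proof (intro equalityI subsetI)
      fix y assume "y \<in> (\<lambda>x. x + int 1) ` ?odds"
      then obtain k where "y = 2 * k + 2" "k \<ge> 0"
        using True by (auto elim!: oddE)
      then show "y \<in> (\<lambda>x. x + int 2) ` ((*) 2 ` H)"
        using True by auto
    next
      fix y assume "y \<in> (\<lambda>x. x + int 2) ` ((*) 2 ` H)"
      then obtain k where "y = (2 * k + 1) + int 1" "k \<ge> 0"
        using True by auto
      then show "y \<in> (\<lambda>x. x + int 1) ` ?odds"
        using True by (intro image_eqI[of _ _ "2 * k + 1"]) auto
    qed
    then show ?thesis
      using translate[OF double_ambient_subset, of 2] by simp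
  next
    case False
    have "(\<lambda>x. x + int 1) ` ?odds = (*) 2 ` H"
    proof (intro equalityI subsetI)
      fix y assume "y \<in> (\<lambda>x. x + int 1) ` ?odds"
      then obtain k where "y = 2 * (k + 1)" "2 * k + 1 \<in> H"
        by (auto elim!: oddE)
      then show "y \<in> (*) 2 ` H"
        using ambient False by (intro image_eqI[of _ _ "k + 1"]) auto
    next
      fix y assume "y \<in> (*) 2 ` H"
      then obtain k where "y = (2 * k - 1) + int 1" "k \<in> H"
        by auto
      then show "y \<in> (\<lambda>x. x + int 1) ` ?odds"
        using ambient False by (intro image_eqI[of _ _ "2 * k - 1"]) auto
    qed
    then show ?thesis by simp
  qed
  also have "\<dots> = 1 / 2"
    using double_half[of H] ambient_one by simp
  finally show ?thesis .
qed

lemma odds_Un_double_le: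
  assumes "X \<subseteq> H"
  shows "m ({x \<in> H. odd x} \<union> (*) 2 ` X) \<le> 1 / 2 + m X / 2"
proof -
  have "(*) 2 ` X \<subseteq> H"
    using assms double_ambient_subset by blast
  then show ?thesis
    using subadditive[of "{x \<in> H. odd x}" "(*) 2 ` X"] assms
    by (simp add: density_odds double_half subset_iff)
qed

text \<open>Any subset of the ambient set is determined by its odd elements and the halves of its even
  elements. This applies to \<open>X\<^sub>a\<close> and to its complement alike.\<close>

lemma split_odd_even:
  "{x \<in> H. P x} = {x \<in> H. odd x \<and> P x} \<union> (*) 2 ` {x \<in> H. P (2 * x)}"
  by (auto simp: double_mem_iff elim!: evenE)

definition dyadic_set :: "real \<Rightarrow> int set" where
  "dyadic_set a = {x \<in> H. dyadic a x}"

lemma dyadic_set_subset: "dyadic_set a \<subseteq> H"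
  by (auto simp: dyadic_set_def)

lemma dyadic_set_unfold:
  "dyadic_set a =
     (if 1 / 2 \<le> a then {x \<in> H. odd x} else {}) \<union> (*) 2 ` dyadic_set (drop_digit a)"
  unfolding dyadic_set_def
  by (subst split_odd_even) (auto simp: dyadic_odd_iff dyadic_double_iff)

lemma complement_dyadic_set_unfold:
  "H - dyadic_set a =
     (if 1 / 2 \<le> a then {} else {x \<in> H. odd x}) \<union> (*) 2 ` (H - dyadic_set (drop_digit a))"
proof -
  have "H - dyadic_set b = {x \<in> H. \<not> dyadic b x}" for b
    by (auto simp: dyadic_set_def)
  then show ?thesis
    by (simp only:) (subst split_odd_even, auto simp: dyadic_odd_iff dyadic_double_iff)
qed

text \<open>
  Both estimates have to range over all \<open>a\<close>, as the recursion replaces \<open>a\<close> by the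
  number with its first digit dropped.
\<close>

lemma dyadic_set_approx:
  assumes "a \<in> {0..1}"
  shows "m (dyadic_set a) \<le> a + (1 / 2) ^ n \<and> m (H - dyadic_set a) \<le> 1 - a + (1 / 2) ^ n"
  using assms
proof (induction n arbitrary: a)
  case 0
  then show ?case
    using le_one[OF dyadic_set_subset, of a] le_one[of "H - dyadic_set a"] by auto
next
  case (Suc n)
  let ?X = "dyadic_set (drop_digit a)"
  have IH: "m ?X \<le> drop_digit a + (1 / 2) ^ n" "m (H - ?X) \<le> 1 - drop_digit a + (1 / 2) ^ n"
    using Suc.IH[OF drop_digit_in_unit[OF Suc.prems]] by auto
  show ?case
  proof (cases "1 / 2 \<le> a")
    case True
    have "m (dyadic_set a) \<le> 1 / 2 + m ?X / 2"
      using True odds_Un_double_le[OF dyadic_set_subset] by (simp add: dyadic_set_unfold[of a])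
    moreover have "m (H - dyadic_set a) = m (H - ?X) / 2"
      using True double_half[of "H - ?X"] by (simp add: complement_dyadic_set_unfold[of a])
    ultimately show ?thesis
      using IH True by (simp add: drop_digit_def)
  next
    case False
    have "m (dyadic_set a) = m ?X / 2"
      using False double_half[OF dyadic_set_subset] by (simp add: dyadic_set_unfold[of a])
    moreover have "m (H - dyadic_set a) \<le> 1 / 2 + m (H - ?X) / 2"
      using False odds_Un_double_le[of "H - ?X"] by (simp add: complement_dyadic_set_unfold[of a])
    ultimately show ?thesis
      using IH False by (simp add: drop_digit_def)
  qed
qed

lemma density_dyadic_set:
  assumes "a \<in> {0..1}"
  shows "m (dyadic_set a) = a" and "m (H - dyadic_set a) = 1 - a"
proof -
  have "m (dyadic_set a) \<le> a" "m (H - dyadic_set a) \<le> 1 - a"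
    using dyadic_set_approx[OF assms] by (auto intro: le_if_le_add_half_powers)
  then show "m (dyadic_set a) = a" "m (H - dyadic_set a) = 1 - a"
    using one_le_add_complement[OF dyadic_set_subset, of a] by auto
qed

section \<open>The range of the induced quasi-density\<close>

lemma range_density: "m ` Pow H = {0..1}"
proof
  show "m ` Pow H \<subseteq> {0..1}"
    using nonneg le_one by auto
  show "{0..1} \<subseteq> m ` Pow H"
    using density_dyadic_set(1) dyadic_set_subset by (metis PowI image_eqI subsetI)
qed

lemma range_lower_dual: "lower_dual H m ` Pow H = {0..1}"
proof
  show "lower_dual H m ` Pow H \<subseteq> {0..1}"
    using nonneg le_one by (auto simp: lower_dual_def)
  show "{0..1} \<subseteq> lower_dual H m ` Pow H"
  proof
    fix a :: real
    assume "a \<in> {0..1}"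
    then have "a = lower_dual H m (dyadic_set a)"
      by (simp add: lower_dual_def density_dyadic_set(2))
    then show "a \<in> lower_dual H m ` Pow H"
      using dyadic_set_subset by blast
  qed
qed

lemma range_induced: "ran (induced_quasi_density H m) = {0..1}"
proof
  show "ran (induced_quasi_density H m) \<subseteq> {0..1}"
    using nonneg le_one by (auto simp: ran_def induced_quasi_density_def split: if_splits)
  show "{0..1} \<subseteq> ran (induced_quasi_density H m)"
  proof
    fix a :: real
    assume "a \<in> {0..1}"
    then have "induced_quasi_density H m (dyadic_set a) = Some a"
      using dyadic_set_subset
      by (simp add: induced_quasi_density_def lower_dual_def density_dyadic_set)
    then show "a \<in> ran (induced_quasi_density H m)"
      by (rule ranI)
  qed
qed

end

theorem theorem2:
  fixes H :: "int set" and m :: "int set \<Rightarrow> real"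
  assumes "H = UNIV \<or> H = {0..} \<or> H = {1..}"
    and "upper_quasi_density H m"
  shows "ran (induced_quasi_density H m) = {0..1} \<and>
         m ` Pow H = {0..1} \<and>
         lower_dual H m ` Pow H = {0..1}"
proof -
  interpret upper_quasi_density_on H m
    using assms by unfold_locales
  show ?thesis
    using range_induced range_density range_lower_dual by blast
qed

end
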